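(* Let $\mathcal R$ be a commutative ELT ring, and let $A\in(\overline{\mathcal R})^{n\times n}$ be an ELT matrix with ELT characteristic polynomial $p_A(\lambda)$. Then $s(p_A(A))=0$, i.e. every entry of the matrix $p_A(A)$ has layer $0$.
   Context: Let $F$ be a totally ordered abelian group (written additively) and $L$ a commutative ring with unit. The commutative ELT ring $\mathcal R=\mathscr R(L,F)$ is the set of symbols ${}^{[\ell]}a$ ($a\in F$, $\ell\in L$) with multiplication ${}^{[\ell_1]}a_1\cdot{}^{[\ell_2]}a_2={}^{[\ell_1\ell_2]}(a_1+a_2)$ and addition ${}^{[\ell_1]}a_1+{}^{[\ell_2]}a_2$ equal to ${}^{[\ell_1]}a_1$ if $a_1>a_2$, to ${}^{[\ell_2]}a_2$ if $a_1<a_2$, and to ${}^{[\ell_1+\ell_2]}a_1$ if $a_1=a_2$. The layer of ${}^{[\ell]}a$ is $s({}^{[\ell]}a)=\ell$. Set $\overline{\mathcal R}=\mathcal R\cup\{-\infty\}$, where $-\infty+\alpha=\alpha+(-\infty)=\alpha$, $-\infty\cdot\alpha=\alpha\cdot(-\infty)=-\infty$ and $s(-\infty)=0$; this is a commutative semiring with zero $-\infty$ and unit ${}^{[1]}0$. Matrices over $\overline{\mathcal R}$ are added and multiplied as usual, and $I_n$ has diagonal entries ${}^{[1]}0$ and off-diagonal entries $-\infty$. The determinant is $\det(A)=\sum_{\sigma\in S_n}{}^{[\operatorname{sgn}\sigma]}0\cdot a_{1,\sigma(1)}\cdots a_{n,\sigma(n)}$ (also used for matrices over the polynomial semiring $\overline{\mathcal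 R}[\lambda]$). The ELT characteristic polynomial of $A$ is $p_A(\lambda)=\det(\lambda I_n+{}^{[-1]}0\cdot A)\in\overline{\mathcal R}[\lambda]$, and $p_A(A)$ is obtained by substituting $A$ for $\lambda$ in this polynomial (with $A^0=I_n$). *)

theory Defs
  imports
    "HOL-Combinatorics.Permutations"
    "HOL-Computational_Algebra.Polynomial"
    "Jordan_Normal_Form.Matrix"
begin

text \<open>
  The type \<open>('l, 'f) elt\<close> is the ELT ring $\mathscr R(L,F)$ together with $-\infty$:
  \<open>Elt l a\<close> is the symbol of layer \<open>l\<close> and tangible value \<open>a\<close>.
\<close>

datatype ('l, 'f) elt = NegInf | Elt 'l 'f

primrec layer :: "('l::zero, 'f) elt \<Rightarrow> 'l" where
  "layer NegInf = 0"
| "layer (Elt l a) = l"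

text \<open>
  The sort \<open>{comm_ring, comm_monoid_mult}\<close> for the layers describes commutative rings with unit.
  It is used instead of \<^class>\<open>comm_ring_1\<close> because the latter excludes the zero ring.
  The semiring below satisfies \<open>0 \<noteq> 1\<close> in every case, since its zero is $-\infty$.
\<close>

instantiation elt ::
  ("{comm_ring, comm_monoid_mult}", linordered_ab_group_add) comm_semiring_1
begin

definition zero_elt :: "('a, 'b) elt" where
  "0 = NegInf"

definition one_elt :: "('a, 'b) elt" where
  "1 = Elt 1 0"

fun plus_elt :: "('a, 'b) elt \<Rightarrow> ('a, 'b) elt \<Rightarrow> ('a, 'b) elt" where
  "NegInf + y = y"
| "x + NegInf = x"
| "Elt l1 a1 + Elt l2 a2 =
    (if a1 > a2 then Elt l1 a1 else if a1 < a2 then Elt l2 a2 else Elt (l1 + l2) a1)"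

fun times_elt :: "('a, 'b) elt \<Rightarrow> ('a, 'b) elt \<Rightarrow> ('a, 'b) elt" where
  "NegInf * y = NegInf"
| "x * NegInf = NegInf"
| "Elt l1 a1 * Elt l2 a2 = Elt (l1 * l2) (a1 + a2)"

instance
proof
  fix x y z :: "('a, 'b) elt"
  show "x + y + z = x + (y + z)"
    by (cases x; cases y; cases z) (auto simp: add.assoc)
  show "x + y = y + x"
    by (cases x; cases y) (auto simp: add.commute)
  show "0 + x = x"
    by (simp add: zero_elt_def)
  show "x * y * z = x * (y * z)"
    by (cases x; cases y; cases z) (auto simp: mult.assoc add.assoc)
  show "x * y = y * x"
    by (cases x; cases y) (auto simp: mult.commute add.commute)
  show "1 * x = x"
    by (cases x) (auto simp: one_elt_def)
  show "0 * x = 0" "x * 0 = 0"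
    by (cases x; simp add: zero_elt_def)+
  show "(x + y) * z = x * z + y * z"
    by (cases x; cases y; cases z) (auto simp: distrib_right)
  show "(0 :: ('a, 'b) elt) \<noteq> 1"
    by (simp add: zero_elt_def one_elt_def)
qed

end

text \<open>
  The determinant of a square matrix over the polynomial semiring; the signs are constant
  polynomials, as a semiring has no negation.
\<close>

definition elt_poly_det ::
  "('l::{comm_ring, comm_monoid_mult}, 'f::linordered_ab_group_add) elt poly mat
    \<Rightarrow> ('l, 'f) elt poly" where
  "elt_poly_det M =
    (\<Sum>\<sigma> | \<sigma> permutes {0..<dim_row M}.
      [: Elt (if evenperm \<sigma> then 1 else - 1) 0 :] * (\<Prod>i = 0..<dim_row M. M $$ (i, \<sigma> i)))"

definition elt_char_poly ::
  "('l::{comm_ring, comm_monoid_mult}, 'f::linordered_ab_group_add) elt mat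
    \<Rightarrow> ('l, 'f) elt poly" where
  "elt_char_poly A =
    elt_poly_det
      ([:0, 1:] \<cdot>\<^sub>m 1\<^sub>m (dim_row A) + [: Elt (- 1) 0 :] \<cdot>\<^sub>m map_mat (\<lambda>a. [:a:]) A)"

definition poly_subst_mat :: "'a::comm_semiring_1 poly \<Rightarrow> 'a mat \<Rightarrow> 'a mat" where
  "poly_subst_mat p A =
    mat (dim_row A) (dim_row A)
      (\<lambda>(i, j). \<Sum>k\<le>degree p. (coeff p k \<cdot>\<^sub>m (A ^\<^sub>m k)) $$ (i, j))"

end

theory Submission
  imports Defs "HOL-Library.Poly_Mapping" "Jordan_Normal_Form.Char_Poly"
begin

text \<open>
  An ELT computation is the computation of leading terms in a group ring. Let \<open>L[F]\<close> be the group
  ring whose elements are the finite sums \<open>\<Sum>\<^sub>a l\<^sub>a t\<^sup>a\<close>, and say that \<open>l t\<^sup>a + (lower terms)\<close>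
  is led by the symbol with layer \<open>l\<close> and value \<open>a\<close>, where \<open>l = 0\<close> is permitted, and that \<open>0\<close> is led
  by \<open>-\<infinity>\<close>. Sums and products of led elements are led by the sums and products of the symbols
  (\<open>leads_add\<close>, \<open>leads_mult\<close>): adding elements with leading exponents \<open>a > b\<close> leaves the
  coefficient at \<open>a\<close> unchanged, and for \<open>a = b\<close> the coefficients add. It is essential here that \<open>l\<close>
  may vanish, because an ELT sum whose layers cancel keeps its value.

  Replace every entry of \<open>A\<close> by a monomial that it leads, which gives a matrix \<open>B\<close> over a commutative
  ring. Everything in the definition of \<open>p\<^sub>A(A)\<close> is a polynomial expression in the entries of \<open>A\<close>, so
  each entry of \<open>p\<^sub>A(A)\<close> leads the corresponding entry of \<open>p\<^sub>B(B)\<close>, which is \<open>0\<close> by the classical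
  Cayley-Hamilton theorem. A symbol that leads \<open>0\<close> has layer \<open>0\<close>.

  The Cayley-Hamilton theorem over a commutative ring is proved from
  \<open>(\<lambda>I - B) adj(\<lambda>I - B) = p\<^sub>B(\<lambda>) I\<close>: comparing the coefficients of \<open>\<lambda>\<^sup>k\<close>, multiplying by \<open>B\<^sup>k\<close>
  and summing over \<open>k\<close> gives a telescoping sum.
\<close>

section \<open>The Cayley-Hamilton theorem over a commutative ring\<close>

lemma poly_subst_mat_index:
  assumes "A \<in> carrier_mat n n" "i < n" "j < n" "degree p \<le> N"
  shows "poly_subst_mat p A $$ (i, j) = (\<Sum>k\<le>N. coeff p k * (A ^\<^sub>m k) $$ (i, j))"
proof -
  have "poly_subst_mat p A $$ (i, j) = (\<Sum>k\<le>degree p. coeff p k * (A ^\<^sub>m k) $$ (i, j))"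
    using assms(1-3) by (auto simp: poly_subst_mat_def intro!: sum.cong)
  also have "\<dots> = (\<Sum>k\<le>N. coeff p k * (A ^\<^sub>m k) $$ (i, j))"
    using assms(4) by (intro sum.mono_neutral_left) (auto simp: coeff_eq_0)
  finally show ?thesis .
qed

lemma pow_mat_Suc_index:
  fixes A :: "'a::comm_semiring_1 mat"
  assumes "A \<in> carrier_mat n n" "i < n" "j < n"
  shows "(A ^\<^sub>m Suc k) $$ (i, j) = (\<Sum>l<n. (A ^\<^sub>m k) $$ (i, l) * A $$ (l, j))"
proof -
  have "A ^\<^sub>m k \<in> carrier_mat n n"
    using assms(1) by (rule pow_carrier_mat)
  then show ?thesis
    using assms by (auto simp: scalar_prod_def lessThan_atLeast0 intro!: sum.cong)
qed

lemma sum_pow_mat_0: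
  fixes A :: "'a::comm_semiring_1 mat"
  assumes "A \<in> carrier_mat n n" "r < n"
  shows "(\<Sum>i<n. (A ^\<^sub>m 0) $$ (r, i) * f i) = f r"
proof -
  have "(\<Sum>i<n. (A ^\<^sub>m 0) $$ (r, i) * f i) = (\<Sum>i<n. if i = r then f i else 0)"
    using assms by (intro sum.cong) auto
  then show ?thesis
    using assms by simp
qed

text \<open>The coefficients of \<open>\<lambda>\<^sup>k\<close> in \<open>(\<lambda>I - B) adj(\<lambda>I - B) = p\<^sub>B(\<lambda>) I\<close>.\<close>

lemma coeff_adj_char_poly_matrix:
  fixes B :: "'a::comm_ring_1 mat"
  assumes B: "B \<in> carrier_mat n n" and "i < n" "j < n"
  defines "C \<equiv> adj_mat (char_poly_matrix B)"
  shows "(case k of 0 \<Rightarrow> 0 | Suc m \<Rightarrow> coeff (C $$ (i, j)) m)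
           - (\<Sum>l<n. B $$ (i, l) * coeff (C $$ (l, j)) k)
         = (if i = j then coeff (char_poly B) k else 0)"
proof -
  let ?M = "char_poly_matrix B"
  have M: "?M \<in> carrier_mat n n"
    using B by simp
  have C: "C \<in> carrier_mat n n" and MC: "?M * C = char_poly B \<cdot>\<^sub>m 1\<^sub>m n"
    unfolding C_def char_poly_def using adj_mat[OF M] by auto
  have "(if i = j then char_poly B else 0) = (?M * C) $$ (i, j)"
    unfolding MC using assms by simp
  also have "\<dots> = (\<Sum>l<n. ?M $$ (i, l) * C $$ (l, j))"
    using M C assms(2,3) by (auto simp: scalar_prod_def lessThan_atLeast0 intro!: sum.cong)
  also have "\<dots> = (\<Sum>l<n. (if l = i then pCons 0 (C $$ (l, j)) else 0)
                        - Polynomial.smult (B $$ (i, l)) (C $$ (l, j)))"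
    using B assms(2) by (intro sum.cong) (auto simp: char_poly_matrix_def)
  also have "\<dots> = pCons 0 (C $$ (i, j)) - (\<Sum>l<n. Polynomial.smult (B $$ (i, l)) (C $$ (l, j)))"
    using assms(2) by (simp add: sum_subtractf)
  finally have "coeff (if i = j then char_poly B else 0) k = coeff \<dots> k"
    by simp
  then show ?thesis
    by (auto simp: coeff_sum coeff_pCons split: nat.splits if_splits)
qed

theorem cayley_hamilton_mat:
  fixes B :: "'a::comm_ring_1 mat"
  assumes B: "B \<in> carrier_mat n n"
  shows "poly_subst_mat (char_poly B) B = 0\<^sub>m n n"
proof (rule eq_matI)
  fix r j assume "r < dim_row (0\<^sub>m n n :: 'a mat)" "j < dim_col (0\<^sub>m n n :: 'a mat)"
  then have r: "r < n" and j: "j < n" by auto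
  define c where "c k i = coeff (adj_mat (char_poly_matrix B) $$ (i, j)) k" for k i
  define N where "N = Suc (degree (char_poly B)
    + (\<Sum>i<n. degree (adj_mat (char_poly_matrix B) $$ (i, j))))"
  \<comment> \<open>With \<open>C\<^sub>k\<close> the coefficient matrix of \<open>\<lambda>\<^sup>k\<close> in the adjugate and \<open>C\<^sub>-\<^sub>1 = 0\<close>, this is the
    entry \<open>(r, j)\<close> of \<open>B\<^sup>k C\<^sub>k\<^sub>-\<^sub>1\<close>.\<close>
  define T where "T k = (case k of 0 \<Rightarrow> 0 | Suc m \<Rightarrow> \<Sum>i<n. (B ^\<^sub>m k) $$ (r, i) * c m i)" for k
  have step: "coeff (char_poly B) k * (B ^\<^sub>m k) $$ (r, j) = T k - T (Suc k)" for k
  proof -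
    have "coeff (char_poly B) k * (B ^\<^sub>m k) $$ (r, j)
        = (\<Sum>i<n. if i = j then (B ^\<^sub>m k) $$ (r, i) * coeff (char_poly B) k else 0)"
      using j by (simp add: mult.commute)
    also have "\<dots> = (\<Sum>i<n. (B ^\<^sub>m k) $$ (r, i) * (if i = j then coeff (char_poly B) k else 0))"
      by (intro sum.cong) auto
    also have "\<dots> = (\<Sum>i<n. (B ^\<^sub>m k) $$ (r, i) *
        ((case k of 0 \<Rightarrow> 0 | Suc m \<Rightarrow> c m i) - (\<Sum>l<n. B $$ (i, l) * c k l)))"
      unfolding c_def using coeff_adj_char_poly_matrix[OF B _ j, of _ k] by (intro sum.cong) auto
    also have "\<dots> = (\<Sum>i<n. (B ^\<^sub>m k) $$ (r, i) * (case k of 0 \<Rightarrow> 0 | Suc m \<Rightarrow> c m i))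
        - (\<Sum>i<n. \<Sum>l<n. (B ^\<^sub>m k) $$ (r, i) * B $$ (i, l) * c k l)"
      by (simp add: right_diff_distrib sum_subtractf sum_distrib_left mult.assoc)
    also have "(\<Sum>i<n. (B ^\<^sub>m k) $$ (r, i) * (case k of 0 \<Rightarrow> 0 | Suc m \<Rightarrow> c m i)) = T k"
      unfolding T_def by (cases k) simp_all
    also have "(\<Sum>i<n. \<Sum>l<n. (B ^\<^sub>m k) $$ (r, i) * B $$ (i, l) * c k l) = T (Suc k)"
    proof -
      have "T (Suc k) = (\<Sum>l<n. \<Sum>i<n. (B ^\<^sub>m k) $$ (r, i) * B $$ (i, l) * c k l)"
        unfolding T_def by (simp del: pow_mat.simps add: pow_mat_Suc_index[OF B r] sum_distrib_right)
      also have "\<dots> = (\<Sum>i<n. \<Sum>l<n. (B ^\<^sub>m k) $$ (r, i) * B $$ (i, l) * c k l)"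
        by (rule sum.swap)
      finally show ?thesis
        by (rule sym)
    qed
    finally show ?thesis .
  qed
  have "c N i = 0" if "i < n" for i
  proof -
    have "degree (adj_mat (char_poly_matrix B) $$ (i, j))
        \<le> (\<Sum>i<n. degree (adj_mat (char_poly_matrix B) $$ (i, j)))"
      using that by (intro member_le_sum) auto
    then show ?thesis
      unfolding c_def N_def by (intro coeff_eq_0) simp
  qed
  then have T_last: "T (Suc N) = 0"
    by (simp add: T_def)
  have "poly_subst_mat (char_poly B) B $$ (r, j) = (\<Sum>k\<le>N. T k - T (Suc k))"
    using poly_subst_mat_index[OF B r j, of "char_poly B" N] by (simp add: N_def step)
  also have "\<dots> = T 0 - T (Suc N)"
    by (rule sum_telescope)
  finally show "poly_subst_mat (char_poly B) B $$ (r, j) = 0\<^sub>m n n $$ (r, j)"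
    using T_last r j by (simp add: T_def)
qed (use B in \<open>auto simp: poly_subst_mat_def\<close>)

section \<open>The coefficient ring\<close>

text \<open>
  The product ring \<open>\<int> \<times> L\<close>. It satisfies \<open>0 \<noteq> 1\<close> even when \<open>L\<close> is the zero ring, so that it is an
  instance of \<^class>\<open>comm_ring_1\<close>, the class in which determinants and characteristic polynomials
  live. Only the component in \<open>L\<close> carries information.
\<close>

datatype 'l int_times = IntTimes (int_part: int) (layer_part: 'l)

instantiation int_times :: ("{comm_ring, comm_monoid_mult}") comm_ring_1
begin

definition "0 = IntTimes 0 0"
definition "1 = IntTimes 1 1"
definition "x + y = IntTimes (int_part x + int_part y) (layer_part x + layer_part y)"
definition "x - y = IntTimes (int_part x - int_part y) (layer_part x - layer_part y)"
definition "- x = IntTimes (- int_part x) (- layer_part x)"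
definition "x * y = IntTimes (int_part x * int_part y) (layer_part x * layer_part y)"

instance
  by standard
    (simp_all add: zero_int_times_def one_int_times_def plus_int_times_def minus_int_times_def
      uminus_int_times_def times_int_times_def algebra_simps int_times.expand)

end

lemma layer_part_simps [simp]:
  "layer_part 0 = 0"
  "layer_part 1 = 1"
  "layer_part (x + y) = layer_part x + layer_part y"
  "layer_part (- x) = - layer_part x"
  "layer_part (x * y) = layer_part x * layer_part y"
  by (simp_all add: zero_int_times_def one_int_times_def plus_int_times_def
      uminus_int_times_def times_int_times_def)

section \<open>ELT symbols as leading terms\<close>

text \<open>
  Elements of the group ring \<open>(\<int> \<times> L)[F]\<close> are finitely supported functions on \<open>F\<close>. Above the
  leading exponent the whole coefficient has to vanish, at the leading exponent only the
  component in \<open>L\<close> is prescribed: the unit of the group ring then has the leading symbol \<open>1\<close>, and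
  so do the monomials \<open>(m, 1) t\<^sup>0\<close> for every other integer \<open>m\<close>.
\<close>

fun leads ::
  "('l::{comm_ring, comm_monoid_mult}, 'f::linordered_ab_group_add) elt
    \<Rightarrow> ('f \<Rightarrow>\<^sub>0 'l int_times) \<Rightarrow> bool" where
  "leads NegInf f \<longleftrightarrow> f = 0"
| "leads (Elt l a) f \<longleftrightarrow>
     layer_part (Poly_Mapping.lookup f a) = l \<and> (\<forall>b>a. Poly_Mapping.lookup f b = 0)"

lemma layer_eq_0_if_leads_0: "leads x 0 \<Longrightarrow> layer x = 0"
  by (cases x) auto

lemma leads_0: "leads 0 0"
  by (simp add: zero_elt_def)

lemma leads_single: "leads (Elt (layer_part c) a) (Poly_Mapping.single a c)"
  by (auto simp: lookup_single)

lemma leads_1: "leads 1 1"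
  using leads_single[of 1 0] by (simp add: one_elt_def)

lemma leads_add:
  assumes "leads x f" "leads y g"
  shows "leads (x + y) (f + g)"
  using assms by (cases x; cases y) (auto simp: lookup_add)

text \<open>Since \<open>F\<close> is a group, a product is a convolution with a single summation index.\<close>

lemma lookup_mult_group:
  fixes f g :: "'f::ab_group_add \<Rightarrow>\<^sub>0 'a::comm_ring_1"
  shows "Poly_Mapping.lookup (f * g) k
    = (\<Sum>l. Poly_Mapping.lookup f l * Poly_Mapping.lookup g (k - l))"
proof -
  have "k = l + q \<longleftrightarrow> q = k - l" for l q
    by (auto simp: algebra_simps)
  then show ?thesis
    by (simp add: lookup_mult)
qed

text \<open>
  If \<open>f\<close> vanishes above \<open>a\<close> and \<open>g\<close> above \<open>b\<close>, then the only term of the convolution that can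
  contribute at an exponent \<open>k \<ge> a + b\<close> is the one with \<open>c = a\<close> and \<open>k - c = b\<close>.
\<close>

lemma leads_mult:
  assumes "leads x f" "leads y g"
  shows "leads (x * y) (f * g)"
proof (cases "x = NegInf \<or> y = NegInf")
  case True
  then show ?thesis
    using assms by (cases x; cases y) auto
next
  case False
  then obtain l a m b where xy: "x = Elt l a" "y = Elt m b"
    by (metis elt.exhaust)
  have f: "Poly_Mapping.lookup f c = 0" if "c > a" for c
    using assms xy that by simp
  have g: "Poly_Mapping.lookup g c = 0" if "c > b" for c
    using assms xy that by simp
  have above: "Poly_Mapping.lookup f c * Poly_Mapping.lookup g (k - c) = 0"
    if "k > a + b \<or> k = a + b \<and> c \<noteq> a" for k c
  proof (cases "c > a")
    case False
    then have "c \<le> a" by simp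
    have "b + c < k"
    proof (cases "k = a + b")
      case True
      then have "c < a"
        using that \<open>c \<le> a\<close> by auto
      then show ?thesis
        using True by (simp add: add.commute)
    next
      case False
      have "b + c \<le> a + b"
        using \<open>c \<le> a\<close> by (simp add: add.commute)
      also have "\<dots> < k"
        using False that by auto
      finally show ?thesis .
    qed
    then have "k - c > b"
      by (simp add: less_diff_eq)
    then show ?thesis
      by (simp add: g)
  qed (simp add: f)
  have "Poly_Mapping.lookup (f * g) k = 0" if "k > a + b" for k
    using above that by (simp add: lookup_mult_group)
  moreover have "Poly_Mapping.lookup (f * g) (a + b)
      = Poly_Mapping.lookup f a * Poly_Mapping.lookup g b"
  proof -
    have single_term: "(\<lambda>c. Poly_Mapping.lookup f c * Poly_Mapping.lookup g (a + b - c))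
        = (\<lambda>c. Poly_Mapping.lookup f a * Poly_Mapping.lookup g b when c = a)"
      using above[of "a + b"] by (auto simp: when_def)
    show ?thesis
      unfolding lookup_mult_group single_term by simp
  qed
  ultimately show ?thesis
    using assms xy by simp
qed

lemma leads_sum:
  assumes "\<And>i. i \<in> I \<Longrightarrow> leads (x i) (f i)"
  shows "leads (\<Sum>i\<in>I. x i) (\<Sum>i\<in>I. f i)"
  using assms by (induction I rule: infinite_finite_induct) (auto intro: leads_0 leads_add)

fun monomial_of :: "('l::{comm_ring, comm_monoid_mult}, 'f::linordered_ab_group_add) elt
    \<Rightarrow> ('f \<Rightarrow>\<^sub>0 'l int_times)" where
  "monomial_of NegInf = 0"
| "monomial_of (Elt l a) = Poly_Mapping.single a (IntTimes 0 l)"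

lemma leads_monomial_of: "leads x (monomial_of x)"
  by (cases x) (auto simp: lookup_single)

section \<open>Polynomials and matrices\<close>

definition leads_poly ::
  "('l::{comm_ring, comm_monoid_mult}, 'f::linordered_ab_group_add) elt poly
    \<Rightarrow> ('f \<Rightarrow>\<^sub>0 'l int_times) poly \<Rightarrow> bool" where
  "leads_poly p q \<longleftrightarrow> (\<forall>k. leads (coeff p k) (coeff q k))"

lemma leads_poly_0: "leads_poly 0 0"
  by (simp add: leads_poly_def leads_0)

lemma leads_poly_pCons: "leads x f \<Longrightarrow> leads_poly p q \<Longrightarrow> leads_poly (pCons x p) (pCons f q)"
  by (auto simp: leads_poly_def coeff_pCons split: nat.splits)

lemma leads_poly_const: "leads x f \<Longrightarrow> leads_poly [:x:] [:f:]"
  by (intro leads_poly_pCons leads_poly_0)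

lemma leads_poly_1: "leads_poly 1 1"
  using leads_poly_const[OF leads_1] by (simp add: one_pCons)

lemma leads_poly_add: "leads_poly p q \<Longrightarrow> leads_poly p' q' \<Longrightarrow> leads_poly (p + p') (q + q')"
  by (simp add: leads_poly_def leads_add)

lemma leads_poly_mult: "leads_poly p q \<Longrightarrow> leads_poly p' q' \<Longrightarrow> leads_poly (p * p') (q * q')"
  by (simp add: leads_poly_def coeff_mult leads_mult leads_sum)

lemma leads_poly_sum:
  assumes "\<And>i. i \<in> I \<Longrightarrow> leads_poly (p i) (q i)"
  shows "leads_poly (\<Sum>i\<in>I. p i) (\<Sum>i\<in>I. q i)"
  using assms by (induction I rule: infinite_finite_induct) (auto intro: leads_poly_0 leads_poly_add)

lemma leads_poly_prod:
  assumes "\<And>i. i \<in> I \<Longrightarrow> leads_poly (p i) (q i)"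
  shows "leads_poly (\<Prod>i\<in>I. p i) (\<Prod>i\<in>I. q i)"
  using assms by (induction I rule: infinite_finite_induct) (auto intro: leads_poly_1 leads_poly_mult)

lemma leads_minus_1: "leads (Elt (- 1) 0) (- 1)"
  by (auto simp: lookup_one)

lemma leads_sign:
  "leads (Elt (if evenperm \<sigma> then 1 else - 1) 0) (if evenperm \<sigma> then 1 else - 1)"
  using leads_1 leads_minus_1 by (simp add: one_elt_def)

text \<open>
  The ELT determinant replaces negation by multiplication with \<open>Elt (- 1) 0\<close>. This symbol leads
  \<open>- 1\<close>, so both characteristic polynomials are the same expression in led entries.
\<close>

lemma leads_char_poly:
  assumes A: "A \<in> carrier_mat n n"
    and B: "B \<in> carrier_mat n n"
    and AB: "\<And>i j. i < n \<Longrightarrow> j < n \<Longrightarrow> leads (A $$ (i, j)) (B $$ (i, j))"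
  shows "leads_poly (elt_char_poly A) (char_poly B)"
proof -
  let ?M = "[:0, 1:] \<cdot>\<^sub>m 1\<^sub>m n + [: Elt (- 1) 0 :] \<cdot>\<^sub>m map_mat (\<lambda>a. [:a:]) A"
  have entry: "leads_poly (?M $$ (i, j)) (char_poly_matrix B $$ (i, j))" if "i < n" "j < n" for i j
  proof -
    have "leads_poly ([:0, 1:] * (if i = j then 1 else 0) + [: Elt (- 1) 0 :] * [:A $$ (i, j):])
        ([:0, 1:] * (if i = j then 1 else 0) + [: - 1 :] * [:B $$ (i, j):])"
      using that
      by (auto intro!: leads_poly_add leads_poly_mult leads_poly_pCons leads_poly_0 leads_poly_1
          leads_0 leads_1 leads_minus_1 AB simp del: mult_pCons_left mult_pCons_right leads.simps)
    then show ?thesis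
      using A B that by (simp add: char_poly_matrix_def)
  qed
  have det: "char_poly B = (\<Sum>\<sigma> | \<sigma> permutes {0..<n}.
      [: if evenperm \<sigma> then 1 else - 1 :] * (\<Prod>i = 0..<n. char_poly_matrix B $$ (i, \<sigma> i)))"
    unfolding char_poly_def det_def'[OF char_poly_matrix_closed[OF B]]
    by (intro sum.cong) (auto simp: sign_def one_pCons)
  have elt: "elt_char_poly A = (\<Sum>\<sigma> | \<sigma> permutes {0..<n}.
      [: Elt (if evenperm \<sigma> then 1 else - 1) 0 :] * (\<Prod>i = 0..<n. ?M $$ (i, \<sigma> i)))"
    using A by (auto simp: elt_char_poly_def elt_poly_det_def)
  show ?thesis
    unfolding det elt
  proof (intro leads_poly_sum leads_poly_mult leads_poly_const leads_sign leads_poly_prod entry)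
    fix \<sigma> i assume "\<sigma> \<in> {\<sigma>. \<sigma> permutes {0..<n}}" "i \<in> {0..<n}"
    then show "i < n" "\<sigma> i < n"
      using permutes_in_image[of \<sigma> "{0..<n}" i] by auto
  qed
qed

lemma leads_pow_mat:
  assumes A: "A \<in> carrier_mat n n"
    and B: "B \<in> carrier_mat n n"
    and AB: "\<And>i j. i < n \<Longrightarrow> j < n \<Longrightarrow> leads (A $$ (i, j)) (B $$ (i, j))"
    and "i < n" "j < n"
  shows "leads ((A ^\<^sub>m k) $$ (i, j)) ((B ^\<^sub>m k) $$ (i, j))"
  using \<open>j < n\<close>
proof (induction k arbitrary: j)
  case 0
  then show ?case
    using A B \<open>i < n\<close> by (auto simp: leads_0 leads_1)
next
  case (Suc k)
  then show ?case
    unfolding pow_mat_Suc_index[OF A \<open>i < n\<close> Suc.prems] pow_mat_Suc_index[OF B \<open>i < n\<close> Suc.prems]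
    by (intro leads_sum leads_mult AB) auto
qed

lemma leads_poly_subst_mat:
  assumes A: "A \<in> carrier_mat n n"
    and B: "B \<in> carrier_mat n n"
    and AB: "\<And>i j. i < n \<Longrightarrow> j < n \<Longrightarrow> leads (A $$ (i, j)) (B $$ (i, j))"
    and pq: "leads_poly p q"
    and ij: "i < n" "j < n"
  shows "leads (poly_subst_mat p A $$ (i, j)) (poly_subst_mat q B $$ (i, j))"
proof -
  \<comment> \<open>The two degrees can differ, because a symbol of layer \<open>0\<close> can lead \<open>0\<close>.\<close>
  define N where "N = max (degree p) (degree q)"
  have "leads (\<Sum>k\<le>N. coeff p k * (A ^\<^sub>m k) $$ (i, j)) (\<Sum>k\<le>N. coeff q k * (B ^\<^sub>m k) $$ (i, j))"
    using pq by (intro leads_sum leads_mult leads_pow_mat[OF A B AB ij]) (simp add: leads_poly_def)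
  then show ?thesis
    using poly_subst_mat_index[OF A ij, of p N] poly_subst_mat_index[OF B ij, of q N]
    by (simp add: N_def)
qed

theorem corollary2p39:
  fixes A :: "('l::{comm_ring, comm_monoid_mult}, 'f::linordered_ab_group_add) elt mat"
    and n :: nat
  assumes "A \<in> carrier_mat n n"
  shows "map_mat layer (poly_subst_mat (elt_char_poly A) A) = 0\<^sub>m n n"
proof (rule eq_matI)
  fix i j
  assume "i < dim_row (0\<^sub>m n n :: 'l mat)" "j < dim_col (0\<^sub>m n n :: 'l mat)"
  then have ij: "i < n" "j < n" by auto
  define B where "B = map_mat monomial_of A"
  have B: "B \<in> carrier_mat n n"
    using assms by (simp add: B_def)
  have AB: "leads (A $$ (i, j)) (B $$ (i, j))" if "i < n" "j < n" for i j
    using assms that by (simp add: B_def leads_monomial_of)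
  have "leads (poly_subst_mat (elt_char_poly A) A $$ (i, j))
      (poly_subst_mat (char_poly B) B $$ (i, j))"
    by (rule leads_poly_subst_mat[OF assms B AB leads_char_poly[OF assms B AB] ij])
  then have "leads (poly_subst_mat (elt_char_poly A) A $$ (i, j)) 0"
    using ij by (simp add: cayley_hamilton_mat[OF B])
  then show "map_mat layer (poly_subst_mat (elt_char_poly A) A) $$ (i, j) = 0\<^sub>m n n $$ (i, j)"
    using assms ij by (simp add: layer_eq_0_if_leads_0 poly_subst_mat_def)
qed (use assms in \<open>auto simp: poly_subst_mat_def\<close>)

end
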